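(* Let $X$ be a real Hilbert space. For any $\chi : (0,\infty) \to (0,\infty)$ and any $\varepsilon>0$, put $$\psi_\chi(\varepsilon):=\frac{\chi(2\varepsilon)}4.$$ Let $\chi : (0,\infty) \to (0,\infty)$ and let $A$ be a maximally monotone operator on $X$ such that $R_A$ is super strongly nonexpansive with modulus $\chi$. Then $A$ is inverse uniformly monotone with modulus $\psi_\chi$.
   Context: Let $X$ be a real Hilbert space. A set-valued operator $A\subseteq X\times X$ is monotone if $\langle a-c,b-d\rangle\ge0$ for all $(a,b),(c,d)\in A$; it is maximally monotone if it is maximal among monotone operators with respect to inclusion. $A$ is uniformly monotone with modulus $\psi:(0,\infty)\to(0,\infty)$ if for all $\varepsilon>0$ and all $(a,b),(c,d)\in A$ with $\|a-c\|\ge\varepsilon$, $\psi(\varepsilon)\le\langle a-c,b-d\rangle$; $A$ is inverse uniformly monotone with modulus $\psi$ if $A^{-1}=\{(b,a)\mid(a,b)\in A\}$ is uniformly monotone with modulus $\psi$. For $A$ maximally monotone, the resolvent $J_A:=(\mathrm{id}_X+A)^{-1}$ is a single-valued mapping $X\to X$, and the reflected resolvent is $R_A:=2J_A-\mathrm{id}_X:X\to X$. A mapping $T:X\to X$ is super strongly nonexpansive with modulus $\chi:(0,\infty)\to(0,\infty)$ if $\chi$ is an SSNE-modulus for $T$: for any $\varepsilon>0$ and $x,y\in X$ with $\|x-y\|^2-\|Tx-Ty\|^2<\chi(\varepsilon)$, we have $\|(x-y)-(Tx-Ty)\|<\varepsilon$. (Existence of such a $\chi$ is equivalent to $T$ being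 super strongly nonexpansive: $T$ is nonexpansive and, whenever $\|x_n-y_n\|^2-\|Tx_n-Ty_n\|^2\to0$, then $(x_n-y_n)-(Tx_n-Ty_n)\to0$.) *)

theory Defs
  imports "HOL-Analysis.Analysis"
begin

text \<open>
  Real Hilbert spaces are types of sort \<open>{real_inner, complete_space}\<close>. A set-valued operator
  on \<open>'a\<close> is identified with its graph, of type \<open>('a \<times> 'a) set\<close>, so that the inverse operator
  is \<^const>\<open>converse\<close> and inclusion of operators is inclusion of graphs.
\<close>

definition monotone_operator :: "('a::real_inner \<times> 'a) set \<Rightarrow> bool" where
  "monotone_operator A \<longleftrightarrow> (\<forall>(a, b)\<in>A. \<forall>(c, d)\<in>A. (a - c) \<bullet> (b - d) \<ge> 0)"

definition maximally_monotone :: "('a::real_inner \<times> 'a) set \<Rightarrow> bool" where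
  "maximally_monotone A \<longleftrightarrow>
     monotone_operator A \<and> (\<forall>B. monotone_operator B \<and> A \<subseteq> B \<longrightarrow> B = A)"

text \<open>
  A map from \<open>(0, \<infinity>)\<close> to \<open>(0, \<infinity>)\<close> is represented by a function on the reals whose values at
  non-positive arguments are irrelevant.
\<close>

definition is_modulus :: "(real \<Rightarrow> real) \<Rightarrow> bool" where
  "is_modulus f \<longleftrightarrow> (\<forall>\<epsilon>>0. f \<epsilon> > 0)"

definition uniformly_monotone_with ::
    "(real \<Rightarrow> real) \<Rightarrow> ('a::real_inner \<times> 'a) set \<Rightarrow> bool" where
  "uniformly_monotone_with \<psi> A \<longleftrightarrow>
     is_modulus \<psi> \<and>
     (\<forall>\<epsilon>>0. \<forall>(a, b)\<in>A. \<forall>(c, d)\<in>A. norm (a - c) \<ge> \<epsilon> \<longrightarrow> \<psi> \<epsilon> \<le> (a - c) \<bullet> (b - d))"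

definition inverse_uniformly_monotone_with ::
    "(real \<Rightarrow> real) \<Rightarrow> ('a::real_inner \<times> 'a) set \<Rightarrow> bool" where
  "inverse_uniformly_monotone_with \<psi> A \<longleftrightarrow> uniformly_monotone_with \<psi> (A\<inverse>)"

text \<open>
  The pointwise (Minkowski) sum of set-valued operators; not the sum of the graphs as subsets
  of the product space.
\<close>

definition operator_sum ::
    "('a::real_inner \<times> 'a) set \<Rightarrow> ('a \<times> 'a) set \<Rightarrow> ('a \<times> 'a) set" where
  "operator_sum A B = {(x, u + v) | x u v. (x, u) \<in> A \<and> (x, v) \<in> B}"

text \<open>
  For maximally monotone \<open>A\<close> on a Hilbert space the relation below is the graph of a total
  single-valued map (Minty's theorem), so that the description is proper at every point.
  For other operators the value of \<open>resolvent A\<close> may be unspecified.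
\<close>

definition resolvent :: "('a::real_inner \<times> 'a) set \<Rightarrow> 'a \<Rightarrow> 'a" where
  "resolvent A x = (THE y. (x, y) \<in> (operator_sum Id A)\<inverse>)"

definition reflected_resolvent :: "('a::real_inner \<times> 'a) set \<Rightarrow> 'a \<Rightarrow> 'a" where
  "reflected_resolvent A x = 2 *\<^sub>R resolvent A x - x"

text \<open>
  Nonexpansiveness is not listed separately, as it follows: if
  \<open>norm (T x - T y) > norm (x - y)\<close>, the premise below holds for every \<open>\<epsilon> > 0\<close>, which forces
  \<open>x - y = T x - T y\<close>.
\<close>

definition super_strongly_nonexpansive_with ::
    "(real \<Rightarrow> real) \<Rightarrow> ('a::real_inner \<Rightarrow> 'a) \<Rightarrow> bool" where
  "super_strongly_nonexpansive_with chi T \<longleftrightarrow>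
     is_modulus chi \<and>
     (\<forall>\<epsilon>>0. \<forall>x y. (norm (x - y))\<^sup>2 - (norm (T x - T y))\<^sup>2 < chi \<epsilon> \<longrightarrow>
        norm ((x - y) - (T x - T y)) < \<epsilon>)"

definition psi_of :: "(real \<Rightarrow> real) \<Rightarrow> real \<Rightarrow> real" where
  "psi_of chi \<epsilon> = chi (2 * \<epsilon>) / 4"

end

theory Submission
  imports Defs
begin

text \<open>
  A pair \<open>(a, b)\<close> in the graph of \<open>A\<close> is parametrised by \<open>x = a + b\<close>: then \<open>J\<^sub>A x = a\<close>,
  \<open>R\<^sub>A x = a - b\<close> and \<open>x - R\<^sub>A x = 2b\<close>. For a second pair \<open>(c, d)\<close> and \<open>y = c + d\<close>, the
  polarisation identity gives \<open>\<parallel>x - y\<parallel>\<^sup>2 - \<parallel>R\<^sub>A x - R\<^sub>A y\<parallel>\<^sup>2 = 4\<langle>a - c, b - d\<rangle>\<close>, so the condition on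
  \<open>R\<^sub>A\<close> at \<open>2\<epsilon>\<close> is the contrapositive of inverse uniform monotonicity at \<open>\<epsilon>\<close>. Only points of the
  form \<open>a + b\<close> occur, so Minty's theorem is not needed.
\<close>

text \<open>Uniqueness: \<open>a + b = c + d\<close> forces \<open>b - d = - (a - c)\<close>, so
  monotonicity gives \<open>- (norm (a - c))\<^sup>2 \<ge> 0\<close>.\<close>

lemma resolvent_add:
  assumes "monotone_operator A" and ab: "(a, b) \<in> A"
  shows "resolvent A (a + b) = a"
  unfolding resolvent_def
proof (rule the_equality)
  show "(a + b, a) \<in> (operator_sum Id A)\<inverse>"
    using ab by (auto simp: operator_sum_def)
next
  fix c assume "(a + b, c) \<in> (operator_sum Id A)\<inverse>"
  then obtain d where cd: "(c, d) \<in> A" and eq: "a + b = c + d"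
    by (auto simp: operator_sum_def)
  have "(a - c) \<bullet> (b - d) \<ge> 0"
    using assms cd unfolding monotone_operator_def by fast
  moreover have "b - d = - (a - c)"
    using eq by (simp add: algebra_simps)
  ultimately have "(a - c) \<bullet> (a - c) \<le> 0"
    by (metis inner_minus_right neg_0_le_iff_le)
  then show "c = a"
    by (metis eq_iff_diff_eq_0 inner_gt_zero_iff not_le)
qed

lemma reflected_resolvent_add:
  assumes "monotone_operator A" and "(a, b) \<in> A"
  shows "reflected_resolvent A (a + b) = a - b"
  by (simp add: reflected_resolvent_def resolvent_add[OF assms] scaleR_2)

lemma norm_add_diff_polarization:
  fixes u v :: "'a::real_inner"
  shows "(norm (u + v))\<^sup>2 - (norm (u - v))\<^sup>2 = 4 * (u \<bullet> v)"
  by (simp add: power2_norm_eq_inner inner_add inner_diff inner_commute)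

theorem proposition3p8:
  fixes A :: "('a::{real_inner, complete_space} \<times> 'a) set"
    and chi :: "real \<Rightarrow> real"
  assumes "is_modulus chi"
    and "maximally_monotone A"
    and "super_strongly_nonexpansive_with chi (reflected_resolvent A)"
  shows "inverse_uniformly_monotone_with (psi_of chi) A"
proof -
  have mono: "monotone_operator A"
    using assms(2) by (simp add: maximally_monotone_def)
  \<comment> \<open>The inverse operator consists of the pairs \<open>(b, a)\<close>, so the
    distance bound falls on \<open>b - d\<close>.\<close>
  have "psi_of chi \<epsilon> \<le> (b - d) \<bullet> (a - c)"
    if eps: "\<epsilon> > 0" and ab: "(a, b) \<in> A" and cd: "(c, d) \<in> A" and far: "norm (b - d) \<ge> \<epsilon>"
    for \<epsilon> a b c d
  proof (rule ccontr)
    let ?x = "a + b" and ?y = "c + d"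
    let ?R = "reflected_resolvent A"
    assume "\<not> ?thesis"
    \<comment> \<open>The denominator 4 in \<open>psi_of\<close> absorbs the factor 4 from
      polarisation.\<close>
    then have small: "4 * ((a - c) \<bullet> (b - d)) < chi (2 * \<epsilon>)"
      by (simp add: psi_of_def inner_commute)
    have R: "?R ?x = a - b" "?R ?y = c - d"
      using reflected_resolvent_add[OF mono] ab cd by auto
    have sum: "?x - ?y = (a - c) + (b - d)" and diff: "?R ?x - ?R ?y = (a - c) - (b - d)"
      by (simp_all add: R)
    have "(norm (?x - ?y))\<^sup>2 - (norm (?R ?x - ?R ?y))\<^sup>2 < chi (2 * \<epsilon>)"
      using small unfolding sum diff norm_add_diff_polarization .
    then have "norm ((?x - ?y) - (?R ?x - ?R ?y)) < 2 * \<epsilon>"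
      using assms(3) eps unfolding super_strongly_nonexpansive_with_def
      by (meson mult_pos_pos zero_less_numeral)
    \<comment> \<open>This doubling turns the bound \<open>2 * \<epsilon>\<close> into
      \<open>norm (b - d) < \<epsilon>\<close>, against \<open>far\<close>.\<close>
    moreover have "(?x - ?y) - (?R ?x - ?R ?y) = 2 *\<^sub>R (b - d)"
      unfolding sum diff by (simp add: scaleR_2)
    ultimately show False
      using far by simp
  qed
  moreover have "is_modulus (psi_of chi)"
    using assms(1) by (simp add: is_modulus_def psi_of_def)
  ultimately show ?thesis
    unfolding inverse_uniformly_monotone_with_def uniformly_monotone_with_def by blast
qed

end
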